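(* Let $P$ be a finite point multiset in $\mathbb{R}^2$, invariant as a multiset under an orientation-reversing affine involution (an affine map $R(x)=Lx+b$ with $R\circ R=\mathrm{id}$ and $\det L<0$), and write $n=|P|$ (counted with multiplicity). For every integer $k$ with $0\le k\le\lfloor n/4\rfloor$, there are two perpendicular lines whose four open sectors contain, in cyclic order, at most $$k,\quad k,\quad \left\lfloor\frac{n-2k}{2}\right\rfloor,\quad \left\lfloor\frac{n-2k}{2}\right\rfloor$$ points of $P$ (counted with multiplicity).
   Context: Two perpendicular lines divide the plane into four open sectors (open quadrants), listed in cyclic order around the intersection point. Points of $P$ lying on the cutting lines belong to no open sector. *)

theory Defs
  imports "HOL-Analysis.Analysis" "HOL-Library.Multiset"
begin

definition orientation_reversing_affine_involution :: "(real^2 \<Rightarrow> real^2) \<Rightarrow> bool" where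
  "orientation_reversing_affine_involution R \<longleftrightarrow>
     (\<exists>(L :: real^2^2) b. (\<forall>x. R x = L *v x + b) \<and> det L < 0) \<and> R \<circ> R = id"

definition perpendicular_lines :: "(real^2) set \<Rightarrow> (real^2) set \<Rightarrow> bool" where
  "perpendicular_lines l m \<longleftrightarrow>
     (\<exists>c u v. u \<noteq> 0 \<and> v \<noteq> 0 \<and> orthogonal u v \<and>
        l = affine hull {c, c + u} \<and> m = affine hull {c, c + v})"

definition open_sector :: "real^2 \<Rightarrow> real^2 \<Rightarrow> real^2 \<Rightarrow> (real^2) set" where
  "open_sector c u v = {c + s *\<^sub>R u + t *\<^sub>R v | s t. s > 0 \<and> t > 0}"

text \<open>
  The sectors of two distinct lines \<open>l\<close>, \<open>m\<close> meeting in \<open>c\<close>, listed in cyclic order around \<open>c\<close>.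
  The direction vectors \<open>u\<close>, \<open>v\<close> may be negated and swapped, so any sector may come first, in
  either sense of rotation.
\<close>

definition sectors_in_cyclic_order ::
  "(real^2) set \<Rightarrow> (real^2) set \<Rightarrow>
   (real^2) set \<Rightarrow> (real^2) set \<Rightarrow> (real^2) set \<Rightarrow> (real^2) set \<Rightarrow> bool" where
  "sectors_in_cyclic_order l m A B C D \<longleftrightarrow>
     l \<noteq> m \<and>
     (\<exists>c u v. u \<noteq> 0 \<and> v \<noteq> 0 \<and>
        {l, m} = {affine hull {c, c + u}, affine hull {c, c + v}} \<and>
        A = open_sector c u v \<and> B = open_sector c (- u) v \<and>
        C = open_sector c (- u) (- v) \<and> D = open_sector c u (- v))"

definition points_in :: "'a multiset \<Rightarrow> 'a set \<Rightarrow> nat" where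
  "points_in P S = size {#x \<in># P. x \<in> S#}"

end

(*
  For a unit vector u with normal v = rot u, cut by the line x . u = a, leaving at most 2k points in
  front and n - 2k behind, and by a median line x . v = b.  The admissible triples (u, a, b) with a, b
  bounded form a compact set whose fibres over the circle are rectangles, so this set is connected.
  It is covered by the closed sets "front right at most k, back left at most (n-2k)/2" and its
  mirror image, and any triple in both of them solves the problem.  Rotating u by a right angle shows that
  some u0 satisfies L u0 . L (rot u0) = 0; for this u0 the map R carries an admissible pair of
  perpendicular lines to another such pair, exchanging left and right.  So both closed sets are
  nonempty, and they meet by connectedness.
*)
theory Submission
  imports Defs
begin

text \<open>Serves as the intermediate value theorem for point counts, which are not continuous but
  do define closed conditions.\<close>

lemma connected_closed_cover_meet:
  assumes "connected S" "closed A" "closed B" "S \<subseteq> A \<union> B" "A \<inter> S \<noteq> {}" "B \<inter> S \<noteq> {}"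
  shows "\<exists>x\<in>S. x \<in> A \<and> x \<in> B"
  using assms connected_closedD[of S A B] by blast

section \<open>Counting points of a multiset\<close>

lemma points_in_le_size: "points_in P S \<le> size P"
  by (simp add: points_in_def size_filter_mset_lesseq)

lemma points_in_empty [simp]: "points_in P {} = 0"
  by (simp add: points_in_def)

lemma points_in_add:
  assumes "A \<inter> B = {}" "A \<union> B \<subseteq> C"
  shows "points_in P A + points_in P B \<le> points_in P C"
  using assms by (induction P) (auto simp: points_in_def)

lemma points_in_invariant:
  assumes "image_mset R P = P"
  shows "points_in P S = points_in P (R -` S)"
proof -
  have "points_in P S = points_in (image_mset R P) S"
    using assms by simp
  also have "\<dots> = points_in P (R -` S)"
    by (simp add: points_in_def filter_mset_image_mset)
  finally show ?thesis .
qed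

text \<open>Lower semicontinuity of the count: a point inside an open region stays inside when the
  parameter \<open>y\<close> moves slightly, so small moves lose no points.\<close>

lemma open_le_points_in:
  assumes "\<And>x. open {y. x \<in> S y}"
  shows "open {y. j \<le> points_in P (S y)}"
proof (induction P arbitrary: j)
  case empty
  show ?case by (simp add: points_in_def)
next
  case (add x P)
  \<comment> \<open>Either \<open>P\<close> alone supplies \<open>j\<close> points, or
    \<open>x\<close> supplies one of them. For \<open>j = 0\<close> the truncated
    \<open>j - 1\<close> is harmless, since the first set is then everything.\<close>
  have "{y. j \<le> points_in (add_mset x P) (S y)} =
      {y. j \<le> points_in P (S y)} \<union> ({y. x \<in> S y} \<inter> {y. j - 1 \<le> points_in P (S y)})"
    by (auto simp: points_in_def split: if_splits)
  then show ?case
    using add assms by (auto intro!: open_Un open_Int)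
qed

lemma closed_points_in_le:
  assumes "\<And>x. open {y. x \<in> S y}"
  shows "closed {y. points_in P (S y) \<le> j}"
proof -
  have "- {y. points_in P (S y) \<le> j} = {y. Suc j \<le> points_in P (S y)}"
    by auto
  then show ?thesis
    using open_le_points_in[OF assms] by (simp add: closed_def)
qed

section \<open>Cutting off prescribed numbers of points by level sets\<close>

text \<open>Both inequalities are strict: points on the level set count on neither side, so ties do
  no harm and the condition is closed.\<close>

definition cuts :: "'a multiset \<Rightarrow> ('a \<Rightarrow> real) \<Rightarrow> nat \<Rightarrow> nat \<Rightarrow> real \<Rightarrow> bool" where
  "cuts P f i j a \<longleftrightarrow> points_in P {x. a < f x} \<le> i \<and> points_in P {x. f x < a} \<le> j"

lemma closed_cuts:
  fixes f :: "'b::topological_space \<Rightarrow> 'a \<Rightarrow> real"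
  assumes "\<And>x. continuous_on UNIV (\<lambda>y. f y x)" "continuous_on UNIV g"
  shows "closed {y. cuts P (f y) i j (g y)}"
proof -
  have "closed {y. points_in P {x. g y < f y x} \<le> i}" "closed {y. points_in P {x. f y x < g y} \<le> j}"
    by (intro closed_points_in_le; simp add: open_Collect_less assms)+
  then show ?thesis
    unfolding cuts_def by (rule closed_Collect_conj)
qed

text \<open>Raising the level shrinks the front and enlarges the back, so a level between two cuts
  inherits one bound from each.\<close>

lemma is_interval_cuts: "is_interval {a \<in> {-M..M}. cuts P f i j a}"
proof -
  have *: "points_in P A \<le> points_in P B" if "A \<subseteq> B" for A B :: "'a set"
    using points_in_add[of A "{}" B P] that by simp
  have "cuts P f i j c" if "cuts P f i j a" "cuts P f i j b" "a \<le> c" "c \<le> b" for a b c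
    using that *[of "{x. c < f x}" "{x. a < f x}"] *[of "{x. f x < c}" "{x. f x < b}"]
    by (force simp: cuts_def)
  then show ?thesis
    unfolding is_interval_1 by auto
qed

text \<open>If both bounds failed at one level, at least \<open>i + j + 2\<close> points would lie
  off it. Nothing lies above \<open>M\<close> or below \<open>-M\<close>. The slack of 1 admits
  medians for odd sizes.\<close>

lemma cuts_exists:
  assumes "size P \<le> i + j + 1" "\<And>x. x \<in># P \<Longrightarrow> \<bar>f x\<bar> \<le> M" "0 \<le> M"
  shows "\<exists>a\<in>{-M..M}. cuts P f i j a"
proof -
  let ?A = "{a. points_in P {x. a < f x} \<le> i}" and ?B = "{a. points_in P {x. f x < a} \<le> j}"
  have "closed ?A" "closed ?B"
    by (intro closed_points_in_le; simp add: open_Collect_less)+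
  moreover have "{-M..M} \<subseteq> ?A \<union> ?B"
  proof
    fix a assume "a \<in> {-M..M}"
    have "points_in P {x. a < f x} + points_in P {x. f x < a} \<le> size P"
      using points_in_add[of "{x. a < f x}" "{x. f x < a}" UNIV P] points_in_le_size[of P UNIV]
      by force
    then show "a \<in> ?A \<union> ?B"
      using assms(1) by auto
  qed
  moreover have "points_in P {x. M < f x} = 0" "points_in P {x. f x < - M} = 0"
    using assms(2) by (force simp: points_in_def abs_le_iff)+
  then have "M \<in> ?A" "-M \<in> ?B"
    by simp_all
  moreover have "connected {-M..M}" "M \<in> {-M..M}" "-M \<in> {-M..M}"
    using assms(3) by auto
  ultimately show ?thesis
    using connected_closed_cover_meet[of "{-M..M}" ?A ?B] unfolding cuts_def by blast
qed

section \<open>Orthonormal frames in the plane\<close>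

definition rot :: "real^2 \<Rightarrow> real^2" where
  "rot u = vector [- (u$2), u$1]"

lemma rot_nth [simp]: "rot u $ 1 = - (u$2)" "rot u $ 2 = u$1"
  by (simp_all add: rot_def)

lemma inner_2: "x \<bullet> y = x$1 * y$1 + x$2 * y$2" for x y :: "real^2"
  by (simp add: inner_vec_def sum_2)

lemma norm_1_2: "norm u = 1 \<longleftrightarrow> u$1 * u$1 + u$2 * u$2 = 1" for u :: "real^2"
  by (simp add: norm_eq_1 inner_2)

lemma norm_rot [simp]: "norm (rot u) = norm u"
  by (simp add: norm_eq inner_2)

lemma rot_rot [simp]: "rot (rot u) = - u"
  by (simp add: vec_eq_iff forall_2)

lemma inner_rot [simp]: "u \<bullet> rot u = 0" "rot u \<bullet> u = 0"
  by (simp_all add: inner_2)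

lemma inner_frame: "norm u = 1 \<Longrightarrow> u \<bullet> u = 1" "norm u = 1 \<Longrightarrow> rot u \<bullet> rot u = 1"
  by (simp_all add: norm_1_2 inner_2 add.commute)

lemma bounded_linear_rot: "bounded_linear rot"
  by (intro linear_conv_bounded_linear[THEN iffD1] linearI)
    (simp_all add: vec_eq_iff forall_2 algebra_simps)

lemmas continuous_on_rot [continuous_intros] = bounded_linear.continuous_on[OF bounded_linear_rot]

lemma expand_in_frame:
  assumes "norm u = 1"
  shows "x = (x \<bullet> u) *\<^sub>R u + (x \<bullet> rot u) *\<^sub>R rot u"
proof -
  have "x$1 = (x \<bullet> u) * u$1 - (x \<bullet> rot u) * u$2"
    "x$2 = (x \<bullet> u) * u$2 + (x \<bullet> rot u) * u$1"
    using assms unfolding norm_1_2 inner_2 rot_nth by algebra+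
  then show ?thesis
    by (simp add: vec_eq_iff forall_2)
qed

lemma open_sector_frame:
  assumes "norm u = 1" "c = a *\<^sub>R u + b *\<^sub>R rot u" "\<bar>\<sigma>\<bar> = 1" "\<bar>\<tau>\<bar> = 1"
  shows "open_sector c (\<sigma> *\<^sub>R rot u) (\<tau> *\<^sub>R u) =
    {x. 0 < \<tau> * (x \<bullet> u - a) \<and> 0 < \<sigma> * (x \<bullet> rot u - b)}" (is "?L = ?R")
proof
  have uu: "u \<bullet> u = 1" "rot u \<bullet> rot u = 1"
    using assms(1) by (simp_all add: inner_frame)
  have sq: "\<sigma> * \<sigma> = 1" "\<tau> * \<tau> = 1"
    using assms(3,4) abs_mult_self_eq[of \<sigma>] abs_mult_self_eq[of \<tau>] by auto
  show "?L \<subseteq> ?R"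
    using assms(2) uu sq by (auto simp: open_sector_def inner_add_left algebra_simps)
  show "?R \<subseteq> ?L"
  proof
    fix x assume x: "x \<in> ?R"
    \<comment> \<open>The signs square to 1 and cancel; the coefficients are exactly the quantities
      assumed positive.\<close>
    have "x = c + (\<sigma> * (x \<bullet> rot u - b)) *\<^sub>R (\<sigma> *\<^sub>R rot u) + (\<tau> * (x \<bullet> u - a)) *\<^sub>R (\<tau> *\<^sub>R u)"
      using expand_in_frame[OF assms(1), of x] sq
      by (simp add: assms(2) algebra_simps mult.assoc[symmetric])
    then show "x \<in> ?L"
      using x unfolding open_sector_def by blast
  qed
qed

text \<open>The lines are \<open>x \<bullet> u = a\<close> and \<open>x \<bullet> rot u = b\<close>.
  The two sectors in front of the first line are listed first, to receive the bounds
  \<open>k\<close>.\<close>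

lemma perpendicular_lines_sectors:
  assumes "norm u = 1"
  shows "\<exists>l m. perpendicular_lines l m \<and> sectors_in_cyclic_order l m
    {x. a < x \<bullet> u \<and> b < x \<bullet> rot u} {x. a < x \<bullet> u \<and> x \<bullet> rot u < b}
    {x. x \<bullet> u < a \<and> x \<bullet> rot u < b} {x. x \<bullet> u < a \<and> b < x \<bullet> rot u}"
proof -
  define c where "c = a *\<^sub>R u + b *\<^sub>R rot u"
  let ?l = "affine hull {c, c + rot u}" and ?m = "affine hull {c, c + u}"
  have nz: "u \<noteq> 0" "rot u \<noteq> 0"
    using assms norm_rot[of u] by (metis norm_zero zero_neq_one)+
  have "perpendicular_lines ?l ?m"
    unfolding perpendicular_lines_def using nz
    by (intro exI[of _ c] exI[of _ "rot u"] exI[of _ u]) (simp add: orthogonal_def)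
  \<comment> \<open>Equality would make \<open>u\<close> a multiple of the orthogonal vector
    \<open>rot u\<close>.\<close>
  moreover have "?l \<noteq> ?m"
  proof
    assume "?l = ?m"
    then have "c + u \<in> affine hull {c, c + rot u}"
      by (simp add: hull_inc)
    then obtain s t where eq: "c + u = s *\<^sub>R c + t *\<^sub>R (c + rot u)" and st: "s + t = 1"
      unfolding affine_hull_2 by blast
    have "c + u = (s + t) *\<^sub>R c + t *\<^sub>R rot u"
      unfolding eq by (simp add: algebra_simps)
    then have "u = t *\<^sub>R rot u"
      unfolding st by simp
    then have "u \<bullet> u = t *\<^sub>R rot u \<bullet> u"
      by (rule arg_cong)
    then show False using nz by simp
  qed
  then have "sectors_in_cyclic_order ?l ?m
    (open_sector c (rot u) u) (open_sector c (- rot u) u)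
    (open_sector c (- rot u) (- u)) (open_sector c (rot u) (- u))"
    unfolding sectors_in_cyclic_order_def using nz
    by (intro conjI exI[of _ c] exI[of _ "rot u"] exI[of _ u]) simp_all
  moreover have
    "open_sector c (rot u) u = {x. a < x \<bullet> u \<and> b < x \<bullet> rot u}"
    "open_sector c (- rot u) u = {x. a < x \<bullet> u \<and> x \<bullet> rot u < b}"
    "open_sector c (- rot u) (- u) = {x. x \<bullet> u < a \<and> x \<bullet> rot u < b}"
    "open_sector c (rot u) (- u) = {x. x \<bullet> u < a \<and> b < x \<bullet> rot u}"
    using open_sector_frame[OF assms c_def, of 1 1] open_sector_frame[OF assms c_def, of "-1" 1]
      open_sector_frame[OF assms c_def, of "-1" "-1"] open_sector_frame[OF assms c_def, of 1 "-1"]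
    by simp_all
  ultimately show ?thesis
    by (intro exI[of _ ?l] exI[of _ ?m]) simp
qed

section \<open>Orthogonal frames with orthogonal image under a linear map\<close>

lemma connected_unit_circle: "connected (sphere (0::real^2) 1)"
  by (intro connected_sphere) simp

text \<open>A quarter turn replaces the pair \<open>u\<close>, \<open>rot u\<close> by
  \<open>rot u\<close>, \<open>-u\<close>, which negates the inner product of the images; hence it
  vanishes somewhere on the circle.\<close>

lemma exists_orthogonal_frame_image:
  fixes L :: "real^2^2"
  shows "\<exists>u. norm u = 1 \<and> (L *v u) \<bullet> (L *v rot u) = 0"
proof -
  define g where "g u = (L *v u) \<bullet> (L *v rot u)" for u
  have g_rot: "g (rot u) = - g u" for u
    by (simp add: g_def inner_commute linear_neg[OF matrix_vector_mul_linear])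
  have cont: "continuous_on UNIV g"
    unfolding g_def
    by (intro continuous_intros matrix_vector_mul_bounded_linear[THEN bounded_linear.continuous_on])
  have "closed {u. g u \<le> 0}" "closed {u. 0 \<le> g u}"
    by (auto intro!: closed_Collect_le cont continuous_intros)
  moreover obtain e where e: "norm (e::real^2) = 1"
    using vector_choose_size[of 1] by auto
  have "{u. g u \<le> 0} \<inter> sphere 0 1 \<noteq> {}" "{u. 0 \<le> g u} \<inter> sphere 0 1 \<noteq> {}"
    using e g_rot[of e] norm_rot[of e] by (smt (verit) disjoint_iff mem_Collect_eq mem_sphere_0)+
  ultimately obtain u where "norm u = 1" "g u \<le> 0" "0 \<le> g u"
    using connected_closed_cover_meet[OF connected_unit_circle, of "{u. g u \<le> 0}" "{u. 0 \<le> g u}"]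
    by force
  then show ?thesis
    unfolding g_def by force
qed

text \<open>A singular value decomposition of \<open>L\<close>; the negative determinant fixes the
  sign in front of \<open>q\<close>.\<close>

lemma reversing_frame_image:
  fixes L :: "real^2^2"
  assumes "det L < 0"
  shows "\<exists>u w p q. norm u = 1 \<and> norm w = 1 \<and> 0 < p \<and> 0 < q \<and>
    L *v u = p *\<^sub>R w \<and> L *v rot u = - q *\<^sub>R rot w"
proof -
  obtain u where u: "norm u = 1" "(L *v u) \<bullet> (L *v rot u) = 0"
    using exists_orthogonal_frame_image by blast
  define y where "y = L *v u"
  define z where "z = L *v rot u"
  \<comment> \<open>The left side is \<open>z \<bullet> rot y\<close>, the determinant of the image
    frame.\<close>
  have "y$1 * z$2 - y$2 * z$1 = det L * (u$1 * u$1 + u$2 * u$2)"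
    by (simp add: y_def z_def det_2 matrix_vector_mult_def sum_2 algebra_simps)
  then have neg: "z \<bullet> rot y < 0"
    using u(1) assms unfolding norm_1_2 by (simp add: inner_2 algebra_simps)
  then have "y \<noteq> 0" by (auto simp: inner_2)
  define p where "p = norm y"
  define w where "w = (1 / p) *\<^sub>R y"
  have p: "p > 0" and y: "y = p *\<^sub>R w" and w: "norm w = 1"
    using \<open>y \<noteq> 0\<close> by (auto simp: p_def w_def)
  have rot_y: "rot y = p *\<^sub>R rot w"
    by (simp add: y vec_eq_iff forall_2)
  define q where "q = - (z \<bullet> rot w)"
  have "q > 0"
    using neg p by (simp add: q_def rot_y mult_less_0_iff)
  have "z \<bullet> w = 0"
    using u(2) p by (simp add: y_def[symmetric] z_def[symmetric] y inner_commute)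
  then have "z = - q *\<^sub>R rot w"
    using expand_in_frame[OF w, of z] by (simp add: q_def)
  then show ?thesis
    using u(1) w p \<open>q > 0\<close> y unfolding y_def z_def by blast
qed

section \<open>Perpendicular cuts\<close>

definition admissible :: "(real^2) multiset \<Rightarrow> nat \<Rightarrow> real^2 \<Rightarrow> real \<Rightarrow> real \<Rightarrow> bool" where
  "admissible P k u a b \<longleftrightarrow> cuts P (\<lambda>x. x \<bullet> u) (2 * k) (size P - 2 * k) a \<and>
     cuts P (\<lambda>x. x \<bullet> rot u) (size P div 2) (size P div 2) b"

text \<open>Front means \<open>a < x \<bullet> u\<close> and left means
  \<open>b < x \<bullet> rot u\<close>. The bounds concern diagonally opposite sectors, here front
  left and back right.\<close>

definition left_light :: "(real^2) multiset \<Rightarrow> nat \<Rightarrow> real^2 \<Rightarrow> real \<Rightarrow> real \<Rightarrow> bool" where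
  "left_light P k u a b \<longleftrightarrow> points_in P {x. a < x \<bullet> u \<and> b < x \<bullet> rot u} \<le> k \<and>
     points_in P {x. x \<bullet> u < a \<and> x \<bullet> rot u < b} \<le> (size P - 2 * k) div 2"

definition right_light :: "(real^2) multiset \<Rightarrow> nat \<Rightarrow> real^2 \<Rightarrow> real \<Rightarrow> real \<Rightarrow> bool" where
  "right_light P k u a b \<longleftrightarrow> points_in P {x. a < x \<bullet> u \<and> x \<bullet> rot u < b} \<le> k \<and>
     points_in P {x. x \<bullet> u < a \<and> b < x \<bullet> rot u} \<le> (size P - 2 * k) div 2"

text \<open>If both alternatives failed, two adjacent sectors would be too full. Together they would
  overfill the front, back, left or right half-plane; for left and right,
  \<open>k + (n - 2 * k) div 2 = n div 2\<close> with \<open>n = size P\<close>.\<close>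

lemma admissible_cases:
  assumes "admissible P k u a b" "2 * k \<le> size P"
  shows "left_light P k u a b \<or> right_light P k u a b"
proof -
  let ?FL = "{x. a < x \<bullet> u \<and> b < x \<bullet> rot u}" and ?FR = "{x. a < x \<bullet> u \<and> x \<bullet> rot u < b}"
  let ?BL = "{x. x \<bullet> u < a \<and> b < x \<bullet> rot u}" and ?BR = "{x. x \<bullet> u < a \<and> x \<bullet> rot u < b}"
  have "points_in P ?FL + points_in P ?FR \<le> points_in P {x. a < x \<bullet> u}"
    "points_in P ?BL + points_in P ?BR \<le> points_in P {x. x \<bullet> u < a}"
    "points_in P ?FL + points_in P ?BL \<le> points_in P {x. b < x \<bullet> rot u}"
    "points_in P ?FR + points_in P ?BR \<le> points_in P {x. x \<bullet> rot u < b}"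
    by (rule points_in_add; force)+
  then show ?thesis
    using assms unfolding admissible_def cuts_def left_light_def right_light_def by linarith
qed

section \<open>Topology of the space of admissible cuts\<close>

lemma closed_admissible: "closed {(u, a, b). admissible P k u a b}"
  unfolding admissible_def case_prod_beta
  by (intro closed_Collect_conj closed_cuts continuous_intros)

lemma closed_left_light: "closed {(u, a, b). left_light P k u a b}"
  unfolding left_light_def case_prod_beta
  by (intro closed_Collect_conj closed_points_in_le; simp;
      intro open_Collect_conj open_Collect_less continuous_intros)

lemma closed_right_light: "closed {(u, a, b). right_light P k u a b}"
  unfolding right_light_def case_prod_beta
  by (intro closed_Collect_conj closed_points_in_le; simp;
      intro open_Collect_conj open_Collect_less continuous_intros)

lemma admissible_exists:
  assumes "\<And>x. x \<in># P \<Longrightarrow> norm x \<le> M" "0 \<le> M" "norm u = 1" "2 * k \<le> size P"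
  shows "\<exists>a\<in>{-M..M}. \<exists>b\<in>{-M..M}. admissible P k u a b"
proof -
  have "\<bar>x \<bullet> v\<bar> \<le> M" if "x \<in># P" "norm v = 1" for x v
    using Cauchy_Schwarz_ineq2[of x v] that assms(1)[of x] by simp
  then have "\<exists>a\<in>{-M..M}. cuts P (\<lambda>x. x \<bullet> u) (2 * k) (size P - 2 * k) a"
    "\<exists>b\<in>{-M..M}. cuts P (\<lambda>x. x \<bullet> rot u) (size P div 2) (size P div 2) b"
    using assms by (auto intro!: cuts_exists)
  then show ?thesis
    unfolding admissible_def by blast
qed

text \<open>By compactness the projection to the circle is a closed map; it is onto with connected
  fibres, so connectedness lifts from the circle. No continuous choice of cuts is required.\<close>

lemma connected_admissible:
  assumes "\<And>x. x \<in># P \<Longrightarrow> norm x \<le> M" "0 \<le> M" "2 * k \<le> size P"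
  shows "connected {(u, a, b). norm u = 1 \<and> a \<in> {-M..M} \<and> b \<in> {-M..M} \<and> admissible P k u a b}"
    (is "connected ?X")
proof -
  have X: "?X = (sphere 0 1 \<times> {-M..M} \<times> {-M..M}) \<inter> {(u, a, b). admissible P k u a b}"
    by auto
  have comp: "compact ?X"
    unfolding X by (intro compact_Int_closed compact_Times closed_admissible) auto
  have cont: "continuous_on ?X fst"
    by (intro continuous_intros)
  have im: "fst ` ?X = sphere 0 1"
  proof
    show "sphere 0 1 \<subseteq> fst ` ?X"
    proof
      fix u :: "real^2" assume "u \<in> sphere 0 1"
      then obtain a b where "(u, a, b) \<in> ?X"
        using admissible_exists[of P M u k] assms by auto
      then show "u \<in> fst ` ?X" by force
    qed
  qed auto
  have fibre: "connected (?X \<inter> fst -` {u})" if "u \<in> sphere 0 1" for u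
  proof -
    \<comment> \<open>For fixed \<open>u\<close> the conditions on \<open>a\<close> and
      \<open>b\<close> are independent, so the fibre is a product of intervals.\<close>
    have "?X \<inter> fst -` {u} = {u} \<times>
        {a \<in> {-M..M}. cuts P (\<lambda>x. x \<bullet> u) (2 * k) (size P - 2 * k) a} \<times>
        {b \<in> {-M..M}. cuts P (\<lambda>x. x \<bullet> rot u) (size P div 2) (size P div 2) b}"
      using that by (auto simp: admissible_def)
    then show ?thesis
      by (simp only:) (intro connected_Times connected_sing is_interval_connected is_interval_cuts)
  qed
  have "connected (?X \<inter> fst -` sphere 0 1)"
    by (rule connected_closed_monotone_preimage[OF cont im
          Abstract_Topology_2.continuous_imp_closed_map[OF _ cont im comp] fibre
          connected_unit_circle order_refl])
  moreover have "?X \<inter> fst -` sphere 0 1 = ?X"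
    by auto
  ultimately show ?thesis by simp
qed

theorem corollary1p7:
  fixes P :: "(real^2) multiset" and R :: "real^2 \<Rightarrow> real^2" and n k :: nat
  assumes "orientation_reversing_affine_involution R"
    and "image_mset R P = P"
    and "n = size P"
    and "k \<le> n div 4"
  shows "\<exists>l m A B C D.
           perpendicular_lines l m \<and> sectors_in_cyclic_order l m A B C D \<and>
           points_in P A \<le> k \<and> points_in P B \<le> k \<and>
           points_in P C \<le> (n - 2 * k) div 2 \<and> points_in P D \<le> (n - 2 * k) div 2"
proof -
  have k: "2 * k \<le> size P"
    using assms(3,4) by linarith
  obtain L d where R: "\<And>x. R x = L *v x + d" and "det L < 0"
    using assms(1) unfolding orientation_reversing_affine_involution_def by blast
  then obtain u w p q where u: "norm u = 1" "norm w = 1" "0 < p" "0 < q"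
    and Lu: "L *v u = p *\<^sub>R w" "L *v rot u = - q *\<^sub>R rot w"
    using reversing_frame_image by metis
  obtain M where M: "\<And>x. x \<in># P \<Longrightarrow> norm x \<le> M" "0 \<le> M"
    using finite_imp_bounded[OF finite_set_mset, of P] unfolding bounded_pos by (metis less_le)
  obtain a b where ab: "a \<in> {-M..M}" "b \<in> {-M..M}" "admissible P k u a b"
    using admissible_exists[OF M u(1) k] by blast
  \<comment> \<open>The levels of the image lines: \<open>R\<close> maps
    \<open>x \<bullet> u = a\<close> to \<open>x \<bullet> w = a'\<close> and
    \<open>x \<bullet> rot u = b\<close> to \<open>x \<bullet> rot w = b'\<close>.\<close>
  define a' where "a' = p * a + d \<bullet> w"
  define b' where "b' = - q * b + d \<bullet> rot w"
  have Rx: "R x \<bullet> w - a' = p * (x \<bullet> u - a)" "R x \<bullet> rot w - b' = q * (b - x \<bullet> rot u)" for x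
  proof -
    have "R x = (x \<bullet> u) *\<^sub>R (L *v u) + (x \<bullet> rot u) *\<^sub>R (L *v rot u) + d"
      unfolding R by (subst expand_in_frame[OF u(1), of x])
        (simp add: matrix_vector_right_distrib matrix_vector_mult_scaleR)
    then have Rx: "R x = ((x \<bullet> u) * p) *\<^sub>R w - ((x \<bullet> rot u) * q) *\<^sub>R rot w + d"
      by (simp add: Lu)
    have "w \<bullet> w = 1" "rot w \<bullet> rot w = 1"
      using u(2) by (simp_all add: inner_frame)
    then show "R x \<bullet> w - a' = p * (x \<bullet> u - a)" "R x \<bullet> rot w - b' = q * (b - x \<bullet> rot u)"
      by (simp_all add: Rx a'_def b'_def inner_add_left inner_diff_left algebra_simps)
  qed
  \<comment> \<open>As \<open>p\<close> and \<open>q\<close> are positive, \<open>R\<close>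
    preserves front and back but exchanges left and right.\<close>
  have sides: "a' < R x \<bullet> w \<longleftrightarrow> a < x \<bullet> u" "R x \<bullet> w < a' \<longleftrightarrow> x \<bullet> u < a"
    "b' < R x \<bullet> rot w \<longleftrightarrow> x \<bullet> rot u < b" "R x \<bullet> rot w < b' \<longleftrightarrow> b < x \<bullet> rot u" for x
    using Rx[of x] u(3,4) by (smt (verit) mult_pos_pos mult_pos_neg mult_eq_0_iff)+
  have "points_in P (Collect Q) = points_in P {x. Q (R x)}" for Q
    using points_in_invariant[OF assms(2), of "Collect Q"] by simp
  note transfer = this[of "\<lambda>x. a' < x \<bullet> w"] this[of "\<lambda>x. x \<bullet> w < a'"]
    this[of "\<lambda>x. b' < x \<bullet> rot w"] this[of "\<lambda>x. x \<bullet> rot w < b'"]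
    this[of "\<lambda>x. a' < x \<bullet> w \<and> b' < x \<bullet> rot w"] this[of "\<lambda>x. a' < x \<bullet> w \<and> x \<bullet> rot w < b'"]
    this[of "\<lambda>x. x \<bullet> w < a' \<and> b' < x \<bullet> rot w"] this[of "\<lambda>x. x \<bullet> w < a' \<and> x \<bullet> rot w < b'"]
  note transfer = transfer[unfolded sides]
  have adm': "admissible P k w a' b'"
    using ab(3) unfolding admissible_def cuts_def
    by (simp add: transfer)
  have swap: "left_light P k w a' b' \<longleftrightarrow> right_light P k u a b"
    "right_light P k w a' b' \<longleftrightarrow> left_light P k u a b"
    unfolding left_light_def right_light_def by (simp_all add: transfer)
  \<comment> \<open>Large enough for one connected space to contain both triples.\<close>
  define N where "N = max M (max \<bar>a'\<bar> \<bar>b'\<bar>)"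
  have N: "0 \<le> N" "\<And>x. x \<in># P \<Longrightarrow> norm x \<le> N"
    using M by (auto simp: N_def intro: max.coboundedI1)
  let ?X = "{(u, a, b). norm u = 1 \<and> a \<in> {-N..N} \<and> b \<in> {-N..N} \<and> admissible P k u a b}"
  let ?A = "{(u, a, b). left_light P k u a b}" and ?B = "{(u, a, b). right_light P k u a b}"
  have "(u, a, b) \<in> ?X"
    using u ab by (auto simp: N_def)
  moreover have "(w, a', b') \<in> ?X"
    using u adm' by (auto simp: N_def)
  moreover have cover: "?X \<subseteq> ?A \<union> ?B"
    using admissible_cases k by blast
  \<comment> \<open>Whichever set contains \<open>(u, a, b)\<close>, the other contains
    \<open>(w, a', b')\<close>.\<close>
  ultimately have "?A \<inter> ?X \<noteq> {}" "?B \<inter> ?X \<noteq> {}"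
    using swap by blast+
  then obtain u a b where "norm u = 1" "left_light P k u a b" "right_light P k u a b"
    using connected_closed_cover_meet[OF connected_admissible[OF N(2) N(1) k] closed_left_light
        closed_right_light cover] by blast
  then show ?thesis
    using perpendicular_lines_sectors[of u a b] assms(3)
    unfolding left_light_def right_light_def by blast
qed

end
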